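(* Let $(P,\preceq)$ be a lattice, let $S=\{x_1,\ldots,x_n\}$ be a finite subset of $P$ with distinct elements such that $x_i\preceq x_j\Rightarrow i\leq j$, and let $f_1,\ldots,f_n:P\to\mathbb{C}$. Let $D=\{d_1,\ldots,d_m\}$ be a finite subset of $P$ with distinct elements, containing all the elements $x_i\wedge x_j$ ($i,j=1,\ldots,n$), and such that $d_i\preceq d_j\Rightarrow i\leq j$. Then, with the matrices $(S)_{f_1,\ldots,f_n}$, $E_D$, $\Xi$, $\Upsilon$ defined in the context, $$(S)_{f_1,\ldots,f_n}=\Upsilon E_D^T=(E_D\circ\Xi)E_D^T,$$ where $\circ$ denotes the Hadamard (entrywise) product.
   Context: The row-adjusted meet matrix $(S)_{f_1,\ldots,f_n}$ is the $n\times n$ matrix whose $ij$ entry is $f_i(x_i\wedge x_j)$. For each $i=1,\ldots,n$ the function $\Psi_{D,f_i}:D\to\mathbb{C}$ is defined inductively by $$\Psi_{D,f_i}(d_k)=f_i(d_k)-\sum_{d_v\prec d_k}\Psi_{D,f_i}(d_v),$$ the sum being over $d_v\in D$; equivalently, $f_i(d_k)=\sum_{d_v\preceq d_k}\Psi_{D,f_i}(d_v)$ for all $k$. $E_D$ is the $n\times m$ matrix with entries $(e_D)_{ij}=1$ if $d_j\preceq x_i$ and $(e_D)_{ij}=0$ otherwise. $\Xi$ is the $n\times m$ matrix with $ij$ entry $\Psi_{D,f_i}(d_j)$. $\Upsilon=(\upsilon_{ij})$ is the $n\times m$ matrix with $\upsilon_{ij}=(e_D)_{ij}\Psi_{D,f_i}(d_j)$,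 i.e. $\Upsilon=E_D\circ\Xi$. *)

theory Defs
  imports Complex_Main "Jordan_Normal_Form.Matrix"
begin

text \<open>
  The lattice \<open>(P, \<preceq>)\<close> is a type of class \<open>lattice\<close>. The enumerations
  \<open>x\<^sub>1, \<dots>, x\<^sub>n\<close>, \<open>d\<^sub>1, \<dots>, d\<^sub>m\<close> and \<open>f\<^sub>1, \<dots>, f\<^sub>n\<close> are functions on \<open>nat\<close> that are
  only used on \<open>{..<n}\<close> and \<open>{..<m}\<close>: indices start at 0, as for the matrices of
  \<open>Jordan_Normal_Form\<close>.
\<close>

text \<open>
  The recursion makes sense only for finite \<open>D\<close>; the value for infinite \<open>D\<close> is a dummy.
  The formula also gives values at points outside \<open>D\<close>, which play no role.
\<close>

function Psi :: "'a::lattice set \<Rightarrow> ('a \<Rightarrow> complex) \<Rightarrow> 'a \<Rightarrow> complex" where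
  "Psi D g z = (if finite D then g z - (\<Sum>v\<in>{v\<in>D. v < z}. Psi D g v) else 0)"
  by pat_completeness auto
termination
proof (relation "measure (\<lambda>(D, g, z). card {v\<in>D. v < z})")
  fix D :: "'a set" and g :: "'a \<Rightarrow> complex" and z v :: 'a
  assume "finite D" and v: "v \<in> {v\<in>D. v < z}"
  then have "{w\<in>D. w < v} \<subset> {w\<in>D. w < z}"
    by (auto intro: less_trans)
  with \<open>finite D\<close> show "((D, g, v), (D, g, z)) \<in> measure (\<lambda>(D, g, z). card {v\<in>D. v < z})"
    by (simp add: psubset_card_mono)
qed simp

declare Psi.simps [simp del]

definition row_adjusted_meet_mat ::
    "nat \<Rightarrow> (nat \<Rightarrow> 'a::lattice) \<Rightarrow> (nat \<Rightarrow> 'a \<Rightarrow> complex) \<Rightarrow> complex mat" where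
  "row_adjusted_meet_mat n x f = mat n n (\<lambda>(i, j). f i (inf (x i) (x j)))"

definition E_mat ::
    "nat \<Rightarrow> nat \<Rightarrow> (nat \<Rightarrow> 'a::lattice) \<Rightarrow> (nat \<Rightarrow> 'a) \<Rightarrow> complex mat" where
  "E_mat n m x d = mat n m (\<lambda>(i, j). if d j \<le> x i then 1 else 0)"

definition Xi_mat ::
    "nat \<Rightarrow> nat \<Rightarrow> (nat \<Rightarrow> 'a::lattice) \<Rightarrow> (nat \<Rightarrow> 'a \<Rightarrow> complex) \<Rightarrow> complex mat" where
  "Xi_mat n m d f = mat n m (\<lambda>(i, j). Psi (d ` {..<m}) (f i) (d j))"

definition Upsilon_mat ::
    "nat \<Rightarrow> nat \<Rightarrow> (nat \<Rightarrow> 'a::lattice) \<Rightarrow> (nat \<Rightarrow> 'a) \<Rightarrow> (nat \<Rightarrow> 'a \<Rightarrow> complex) \<Rightarrow> complex mat" where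
  "Upsilon_mat n m x d f =
     mat n m (\<lambda>(i, j). E_mat n m x d $$ (i, j) * Psi (d ` {..<m}) (f i) (d j))"

text \<open>Entrywise product, intended for matrices of equal dimensions.\<close>

definition hadamard_prod :: "'b::times mat \<Rightarrow> 'b mat \<Rightarrow> 'b mat" (infixl \<open>\<circ>\<^sub>H\<close> 70) where
  "A \<circ>\<^sub>H B = mat (dim_row A) (dim_col A) (\<lambda>(i, j). A $$ (i, j) * B $$ (i, j))"

end

theory Submission
  imports Defs
begin

text \<open>Because \<open>z\<close> itself belongs to \<open>D\<close>, it splits off from the
  elements strictly below it. One unfolding of the recursion at \<open>z\<close> then cancels the
  strict sum, leaving \<open>g z\<close>.\<close>

lemma sum_Psi_le:
  assumes "finite D" "z \<in> D"
  shows "(\<Sum>v\<in>{v\<in>D. v \<le> z}. Psi D g v) = g z"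
proof -
  have "{v\<in>D. v \<le> z} = insert z {v\<in>D. v < z}"
    using assms(2) by (auto simp: le_less)
  then show ?thesis
    using assms(1) by (simp add: Psi.simps[of D g z])
qed

lemma Upsilon_mat_eq_hadamard: "Upsilon_mat n m x d f = E_mat n m x d \<circ>\<^sub>H Xi_mat n m d f"
  by (rule eq_matI) (auto simp: Upsilon_mat_def E_mat_def Xi_mat_def hadamard_prod_def)

text \<open>
  Since \<open>d\<^sub>k \<preceq> x\<^sub>i\<close> and \<open>d\<^sub>k \<preceq> x\<^sub>j\<close> together mean \<open>d\<^sub>k \<preceq> x\<^sub>i \<sqinter> x\<^sub>j\<close>, each entry of the product
  is the sum in \<open>sum_Psi_le\<close> at the meet.
\<close>

lemma index_Upsilon_mult_E_transpose:
  assumes "inj_on d {..<m}" "inf (x i) (x j) \<in> d ` {..<m}" "i < n" "j < n"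
  shows "(Upsilon_mat n m x d f * transpose_mat (E_mat n m x d)) $$ (i, j) = f i (inf (x i) (x j))"
proof -
  let ?D = "d ` {..<m}" and ?z = "inf (x i) (x j)"
  \<comment> \<open>Row \<open>i\<close> of \<open>Upsilon_mat\<close> involves only
    \<open>f i\<close>, so a single function enters each entry of the product.\<close>
  let ?psi = "Psi ?D (f i)"
  have "(Upsilon_mat n m x d f * transpose_mat (E_mat n m x d)) $$ (i, j)
      = (\<Sum>k<m. if d k \<le> ?z then ?psi (d k) else 0)"
    using assms(3,4)
    by (auto simp: Upsilon_mat_def E_mat_def scalar_prod_def atLeast0LessThan intro!: sum.cong)
  \<comment> \<open>The matrix product sums over indices, \<open>Psi\<close> over the set
    \<open>?D\<close>; injectivity of \<open>d\<close> keeps any element from being counted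
    twice.\<close>
  also have "\<dots> = (\<Sum>v\<in>?D. if v \<le> ?z then ?psi v else 0)"
    by (simp add: sum.reindex[OF assms(1)])
  also have "\<dots> = (\<Sum>v\<in>{v\<in>?D. v \<le> ?z}. ?psi v)"
    by (simp add: sum.inter_filter)
  \<comment> \<open>The inversion applies at \<open>?z\<close> because the meet lies in
    \<open>?D\<close>.\<close>
  also have "\<dots> = f i ?z"
    using assms(2) by (intro sum_Psi_le) auto
  finally show ?thesis .
qed

theorem theorem3p1:
  fixes x d :: "nat \<Rightarrow> 'a::lattice"
    and f :: "nat \<Rightarrow> 'a \<Rightarrow> complex"
    and n m :: nat
  assumes x_distinct: "inj_on x {..<n}"
    and x_order: "\<And>i j. i < n \<Longrightarrow> j < n \<Longrightarrow> x i \<le> x j \<Longrightarrow> i \<le> j"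
    and d_distinct: "inj_on d {..<m}"
    and d_order: "\<And>i j. i < m \<Longrightarrow> j < m \<Longrightarrow> d i \<le> d j \<Longrightarrow> i \<le> j"
    and meets_in_D: "\<And>i j. i < n \<Longrightarrow> j < n \<Longrightarrow> inf (x i) (x j) \<in> d ` {..<m}"
  shows "row_adjusted_meet_mat n x f = Upsilon_mat n m x d f * transpose_mat (E_mat n m x d) \<and>
         Upsilon_mat n m x d f * transpose_mat (E_mat n m x d) =
           (E_mat n m x d \<circ>\<^sub>H Xi_mat n m d f) * transpose_mat (E_mat n m x d)"
proof
  show "row_adjusted_meet_mat n x f = Upsilon_mat n m x d f * transpose_mat (E_mat n m x d)"
  proof (rule eq_matI)
    fix i j
    assume "i < dim_row (Upsilon_mat n m x d f * transpose_mat (E_mat n m x d))"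
      and "j < dim_col (Upsilon_mat n m x d f * transpose_mat (E_mat n m x d))"
    then have "i < n" "j < n"
      by (simp_all add: Upsilon_mat_def E_mat_def)
    then show "row_adjusted_meet_mat n x f $$ (i, j)
        = (Upsilon_mat n m x d f * transpose_mat (E_mat n m x d)) $$ (i, j)"
      by (simp add: row_adjusted_meet_mat_def d_distinct meets_in_D
          index_Upsilon_mult_E_transpose del: index_mult_mat)
  qed (simp_all add: row_adjusted_meet_mat_def Upsilon_mat_def E_mat_def)
\<comment> \<open>Both products have the same right factor, so equality of the left factors
  suffices.\<close>
qed (simp add: Upsilon_mat_eq_hadamard)

end
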